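(* Let $1\le m\le n$ be an integer batch-size, and let $B=B_m$ and $B_\mu=B_{\mu,m}$ be the mini-batch operators. For any two functions $J:\mathcal{S}\to\mathbb{R}$ and $J':\mathcal{S}\to\mathbb{R}$, any stationary policy $\mu$, and all $k=1,2,\dots$, $$\max_{i\in\mathcal{S}}|(B^kJ)(i)-(B^kJ')(i)|\le\alpha^k\max_{i\in\mathcal{S}}|J(i)-J'(i)|,$$ $$\max_{i\in\mathcal{S}}|(B_\mu^kJ)(i)-(B_\mu^kJ')(i)|\le\alpha^k\max_{i\in\mathcal{S}}|J(i)-J'(i)|.$$
   Context: A (finite, discounted) Markov decision process is a tuple $(\mathcal{S},\mathcal{U},P,g,\alpha)$ with finite state space $\mathcal{S}=\{1,\dots,n\}$, finite control space $\mathcal{U}$, nonempty subsets $\mathcal{U}(i)\subseteq\mathcal{U}$ of controls associated with each state $i$, transition probabilities $p_{ij}(u)\in[0,1]$ (probability of moving from state $i$ to state $j$ under control $u\in\mathcal{U}(i)$, so $\sum_{j\in\mathcal{S}}p_{ij}(u)=1$), stage cost $g:\mathcal{S}\times\mathcal{U}\to\mathbb{R}$, and discount factor $\alpha\in(0,1)$. Fix such an MDP. A stationary (admissible) policy is a map $\mu:\mathcal{S}\to\mathcal{U}$ with $\mu(i)\in\mathcal{U}(i)$ for all $i$. Mini-batch operators: for an integer batch-size $1\le m\le n$, let $\mathcal{M}_m(i)=\{j\in\mathbb{N}: 1\le j\le m\lfloor (i-1)/m\rfloor\}$ (empty if $\lfloor (i-1)/m\rfloor=0$), so $\mathcal{M}_m(i)\subseteq\{1,\dots,i-1\}$.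 For $J:\mathcal{S}\to\mathbb{R}$, the functions $B_mJ,B_{\mu,m}J:\mathcal{S}\to\mathbb{R}$ are defined recursively in increasing $i$ by $$(B_mJ)(i)=\min_{u\in\mathcal{U}(i)}\left[g(i,u)+\alpha\sum_{j\in\mathcal{S}\setminus\mathcal{M}_m(i)}p_{ij}(u)J(j)+\alpha\sum_{j\in\mathcal{M}_m(i)}p_{ij}(u)(B_mJ)(j)\right],$$ $$(B_{\mu,m}J)(i)=g(i,\mu(i))+\alpha\sum_{j\in\mathcal{S}\setminus\mathcal{M}_m(i)}p_{ij}(\mu(i))J(j)+\alpha\sum_{j\in\mathcal{M}_m(i)}p_{ij}(\mu(i))(B_{\mu,m}J)(j).$$ A superscript $k$ on an operator denotes its $k$-fold composition with itself. *)

theory Defs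
  imports Complex_Main
begin

record 'u mdp =
  num_states :: nat
  controls :: "'u set"
  admissible :: "nat \<Rightarrow> 'u set"
  trans_prob :: "nat \<Rightarrow> 'u \<Rightarrow> nat \<Rightarrow> real"  (* trans_prob M i u j: from i to j under u *)
  stage_cost :: "nat \<Rightarrow> 'u \<Rightarrow> real"
  discount :: real

definition states :: "'u mdp \<Rightarrow> nat set" where
  "states M = {1..num_states M}"

definition is_mdp :: "'u mdp \<Rightarrow> bool" where
  "is_mdp M \<longleftrightarrow>
     finite (controls M) \<and>
     (\<forall>i\<in>states M. admissible M i \<noteq> {} \<and> admissible M i \<subseteq> controls M) \<and>
     (\<forall>i\<in>states M. \<forall>u\<in>admissible M i.
        (\<forall>j\<in>states M. 0 \<le> trans_prob M i u j \<and> trans_prob M i u j \<le> 1) \<and>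
        (\<Sum>j\<in>states M. trans_prob M i u j) = 1) \<and>
     0 < discount M \<and> discount M < 1"

definition stationary_policy :: "'u mdp \<Rightarrow> (nat \<Rightarrow> 'u) \<Rightarrow> bool" where
  "stationary_policy M \<mu> \<longleftrightarrow> (\<forall>i\<in>states M. \<mu> i \<in> admissible M i)"

definition batch :: "nat \<Rightarrow> nat \<Rightarrow> nat set" where
  "batch m i = {j. 1 \<le> j \<and> j \<le> m * ((i - 1) div m)}"

lemma batch_less: "j \<in> batch m i \<Longrightarrow> j < i"
proof -
  assume "j \<in> batch m i"
  then have j: "1 \<le> j" "j \<le> m * ((i - 1) div m)" by (auto simp: batch_def)
  have "m * ((i - 1) div m) \<le> i - 1" by (rule times_div_less_eq_dividend)
  with j show "j < i" by linarith
qed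

(* Functions on the state space are total functions on nat. Only their values on
   the state space matter: at a state, both operators below read J at states only. *)

function mb_opt :: "'u mdp \<Rightarrow> nat \<Rightarrow> (nat \<Rightarrow> real) \<Rightarrow> nat \<Rightarrow> real" where
  "mb_opt M m J i =
     (MIN u\<in>admissible M i.
        stage_cost M i u
        + discount M * (\<Sum>j\<in>states M - batch m i. trans_prob M i u j * J j)
        + discount M * (\<Sum>j\<in>batch m i. trans_prob M i u j * mb_opt M m J j))"
  by pat_completeness auto
termination
  by (relation "measure (\<lambda>(M, m, J, i). i)") (auto dest: batch_less)

function mb_policy ::
    "'u mdp \<Rightarrow> (nat \<Rightarrow> 'u) \<Rightarrow> nat \<Rightarrow> (nat \<Rightarrow> real) \<Rightarrow> nat \<Rightarrow> real" where
  "mb_policy M \<mu> m J i =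
     stage_cost M i (\<mu> i)
     + discount M * (\<Sum>j\<in>states M - batch m i. trans_prob M i (\<mu> i) j * J j)
     + discount M * (\<Sum>j\<in>batch m i. trans_prob M i (\<mu> i) j * mb_policy M \<mu> m J j)"
  by pat_completeness auto
termination
  by (relation "measure (\<lambda>(M, \<mu>, m, J, i). i)") (auto dest: batch_less)

(* The recursive equations loop as rewrite rules. *)
declare mb_opt.simps [simp del] mb_policy.simps [simp del]

end

theory Submission
  imports Defs
begin

text \<open>
  A cost update at state \<open>i\<close> averages, with the weights \<open>p\<^sub>i\<^sub>j(u)\<close>, over old values
  \<open>J j\<close> outside the batch and already updated values inside it. If \<open>J\<close> and \<open>J'\<close> differ by at
  most \<open>c\<close> on the states, then by strong induction on \<open>i\<close> the updated values entering at \<open>i\<close>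
  differ by at most \<open>\<alpha> c \<le> c\<close>. So every value in the average moves by at most \<open>c\<close>, a weighted
  average cannot amplify this, and the factor \<open>\<alpha>\<close> in front shrinks it to \<open>\<alpha> c\<close>; taking minima
  over the same finite set of controls preserves the bound. This is \<open>mb_opt_contraction\<close>.

  The policy operator needs no second argument: it is the optimal operator of the MDP whose only
  admissible control at \<open>i\<close> is \<open>\<mu> i\<close> (\<open>mb_policy_eq_mb_opt\<close>). The \<open>k\<close>-step estimates then
  follow by iterating.
\<close>

lemma abs_Min_image_diff_le:
  fixes f g :: "'a \<Rightarrow> real"
  assumes "finite A" "A \<noteq> {}" and close: "\<And>x. x \<in> A \<Longrightarrow> \<bar>f x - g x\<bar> \<le> c"
  shows "\<bar>(MIN x\<in>A. f x) - (MIN x\<in>A. g x)\<bar> \<le> c"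
proof -
  have one_sided: "(MIN x\<in>A. a x) \<le> (MIN x\<in>A. b x) + c"
    if "\<And>x. x \<in> A \<Longrightarrow> a x \<le> b x + c" for a b :: "'a \<Rightarrow> real"
  proof -
    have "(MIN x\<in>A. b x) \<in> b ` A"
      using assms(1,2) by (intro Min_in) auto
    then obtain x where x: "x \<in> A" "(MIN x\<in>A. b x) = b x"
      by auto
    have "(MIN x\<in>A. a x) \<le> a x"
      using assms(1) x(1) by (intro Min_le) auto
    with that[OF x(1)] x(2) show ?thesis by linarith
  qed
  have "f x \<le> g x + c \<and> g x \<le> f x + c" if "x \<in> A" for x
    using close[OF that] by linarith
  then show ?thesis
    using one_sided[of f g] one_sided[of g f] by fastforce
qed

lemma weighted_average_diff_le:
  fixes p f g :: "'a \<Rightarrow> real"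
  assumes "\<And>j. j \<in> A \<Longrightarrow> 0 \<le> p j" and "(\<Sum>j\<in>A. p j) = 1"
    and "\<And>j. j \<in> A \<Longrightarrow> \<bar>f j - g j\<bar> \<le> c"
  shows "\<bar>(\<Sum>j\<in>A. p j * f j) - (\<Sum>j\<in>A. p j * g j)\<bar> \<le> c"
proof -
  have "\<bar>(\<Sum>j\<in>A. p j * f j) - (\<Sum>j\<in>A. p j * g j)\<bar> = \<bar>\<Sum>j\<in>A. p j * (f j - g j)\<bar>"
    by (simp add: sum_subtractf right_diff_distrib)
  also have "\<dots> \<le> (\<Sum>j\<in>A. \<bar>p j * (f j - g j)\<bar>)"
    by (rule sum_abs)
  also have "\<dots> \<le> (\<Sum>j\<in>A. p j * c)"
    using assms(1,3) by (intro sum_mono) (simp add: abs_mult mult_left_mono)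
  also have "\<dots> = c"
    using assms(2) by (simp flip: sum_distrib_right)
  finally show ?thesis .
qed

lemma batch_subset_states: "i \<in> states M \<Longrightarrow> batch m i \<subseteq> states M"
  using batch_less[of _ m i] by (fastforce simp: states_def batch_def)

lemma finite_states [simp]: "finite (states M)"
  by (simp add: states_def)

text \<open>Merging the two sums of the recursion into one exhibits it as a single average over all
  states, so that the weights add up to one.\<close>
lemma mb_opt_eq_average:
  assumes "i \<in> states M"
  shows "mb_opt M m J i =
    (MIN u\<in>admissible M i. stage_cost M i u + discount M *
      (\<Sum>j\<in>states M. trans_prob M i u j * (if j \<in> batch m i then mb_opt M m J j else J j)))"
proof -
  have "(\<Sum>j\<in>states M. trans_prob M i u j * (if j \<in> batch m i then mb_opt M m J j else J j)) =
      (\<Sum>j\<in>states M - batch m i. trans_prob M i u j * J j)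
      + (\<Sum>j\<in>batch m i. trans_prob M i u j * mb_opt M m J j)" for u
    using batch_subset_states[OF assms, of m]
    by (subst sum.subset_diff[of "batch m i"]) (auto intro!: arg_cong2[where f = "(+)"] sum.cong)
  then show ?thesis
    by (subst mb_opt.simps) (simp add: distrib_left add.assoc)
qed

text \<open>The induction over the states is where \<open>\<alpha> \<le> 1\<close> enters: the updated values inside the batch
  satisfy the sharper bound \<open>\<alpha> c\<close>, which must be relaxed to \<open>c\<close> to be averaged with the rest.\<close>
lemma mb_opt_contraction:
  assumes mdp: "is_mdp M"
    and close: "\<And>j. j \<in> states M \<Longrightarrow> \<bar>J j - J' j\<bar> \<le> c"
    and "i \<in> states M"
  shows "\<bar>mb_opt M m J i - mb_opt M m J' i\<bar> \<le> discount M * c"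
  using \<open>i \<in> states M\<close>
proof (induction i rule: less_induct)
  case (less i)
  have disc: "0 < discount M" "discount M < 1"
    using mdp by (auto simp: is_mdp_def)
  have adm: "finite (admissible M i)" "admissible M i \<noteq> {}"
    using mdp less.prems by (auto simp: is_mdp_def intro: finite_subset)
  have "0 \<le> c"
    using close[OF less.prems] by linarith
  then have "discount M * c \<le> c"
    using disc by (simp add: mult_left_le_one_le)
  let ?K = "\<lambda>J j. if j \<in> batch m i then mb_opt M m J j else J j"
  have K: "\<bar>?K J j - ?K J' j\<bar> \<le> c" if "j \<in> states M" for j
    using less.IH[of j] batch_less[of j m i] close[OF that] that \<open>discount M * c \<le> c\<close> by auto
  show ?case
    unfolding mb_opt_eq_average[OF less.prems]
  proof (rule abs_Min_image_diff_le[OF adm])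
    fix u assume u: "u \<in> admissible M i"
    let ?E = "\<lambda>J. \<Sum>j\<in>states M. trans_prob M i u j * ?K J j"
    have "\<bar>?E J - ?E J'\<bar> \<le> c"
      using mdp less.prems u K by (intro weighted_average_diff_le) (auto simp: is_mdp_def)
    then have "discount M * \<bar>?E J - ?E J'\<bar> \<le> discount M * c"
      using disc by (intro mult_left_mono) auto
    moreover have "\<bar>(stage_cost M i u + discount M * ?E J) - (stage_cost M i u + discount M * ?E J')\<bar>
        = discount M * \<bar>?E J - ?E J'\<bar>"
      using disc by (simp add: abs_mult flip: right_diff_distrib)
    ultimately show "\<bar>(stage_cost M i u + discount M * ?E J)
        - (stage_cost M i u + discount M * ?E J')\<bar> \<le> discount M * c"
      by simp
  qed
qed

lemma mb_opt_iterate_contraction: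
  assumes "is_mdp M" and "\<And>j. j \<in> states M \<Longrightarrow> \<bar>J j - J' j\<bar> \<le> c" and "i \<in> states M"
  shows "\<bar>(mb_opt M m ^^ k) J i - (mb_opt M m ^^ k) J' i\<bar> \<le> discount M ^ k * c"
  using assms(3)
proof (induction k arbitrary: i)
  case 0
  then show ?case using assms(2) by simp
next
  case (Suc k)
  then show ?case
    using mb_opt_contraction[OF assms(1) Suc.IH Suc.prems] by (simp add: mult.assoc)
qed

lemma mb_opt_iterate_MAX_contraction:
  assumes "is_mdp M" and "states M \<noteq> {}"
  shows "(MAX i\<in>states M. \<bar>(mb_opt M m ^^ k) J i - (mb_opt M m ^^ k) J' i\<bar>)
    \<le> discount M ^ k * (MAX i\<in>states M. \<bar>J i - J' i\<bar>)"
proof -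
  have "\<bar>J j - J' j\<bar> \<le> (MAX i\<in>states M. \<bar>J i - J' i\<bar>)" if "j \<in> states M" for j
    using that by (intro Max_ge) auto
  from mb_opt_iterate_contraction[OF assms(1) this] show ?thesis
    using assms(2) by (subst Max_le_iff) auto
qed

definition restrict_to_policy :: "'u mdp \<Rightarrow> (nat \<Rightarrow> 'u) \<Rightarrow> 'u mdp" where
  "restrict_to_policy M \<mu> = M\<lparr>admissible := \<lambda>i. {\<mu> i}\<rparr>"

lemma restrict_to_policy_simps [simp]:
  "states (restrict_to_policy M \<mu>) = states M"
  "controls (restrict_to_policy M \<mu>) = controls M"
  "admissible (restrict_to_policy M \<mu>) i = {\<mu> i}"
  "trans_prob (restrict_to_policy M \<mu>) = trans_prob M"
  "stage_cost (restrict_to_policy M \<mu>) = stage_cost M"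
  "discount (restrict_to_policy M \<mu>) = discount M"
  by (simp_all add: restrict_to_policy_def states_def)

lemma is_mdp_restrict_to_policy:
  assumes "is_mdp M" and "stationary_policy M \<mu>"
  shows "is_mdp (restrict_to_policy M \<mu>)"
  using assms unfolding is_mdp_def stationary_policy_def restrict_to_policy_simps by blast

lemma mb_policy_eq_mb_opt: "mb_policy M \<mu> m J = mb_opt (restrict_to_policy M \<mu>) m J"
proof
  show "mb_policy M \<mu> m J i = mb_opt (restrict_to_policy M \<mu>) m J i" for i
  proof (induction i rule: less_induct)
    case (less i)
    then show ?case
      by (subst mb_policy.simps, subst mb_opt.simps) (simp add: batch_less)
  qed
qed

theorem mainTheorem3:
  fixes M :: "'u mdp" and m k :: nat and \<mu> :: "nat \<Rightarrow> 'u" and J J' :: "nat \<Rightarrow> real"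
  assumes "is_mdp M"
    and "1 \<le> m" and "m \<le> num_states M"
    and "stationary_policy M \<mu>"
    and "1 \<le> k"
  shows "(MAX i\<in>states M. \<bar>(mb_opt M m ^^ k) J i - (mb_opt M m ^^ k) J' i\<bar>)
           \<le> discount M ^ k * (MAX i\<in>states M. \<bar>J i - J' i\<bar>) \<and>
         (MAX i\<in>states M. \<bar>(mb_policy M \<mu> m ^^ k) J i - (mb_policy M \<mu> m ^^ k) J' i\<bar>)
           \<le> discount M ^ k * (MAX i\<in>states M. \<bar>J i - J' i\<bar>)"
proof -
  have nonempty: "states M \<noteq> {}"
    using assms(2,3) by (simp add: states_def)
  have "mb_policy M \<mu> m = mb_opt (restrict_to_policy M \<mu>) m"
    by (rule ext) (rule mb_policy_eq_mb_opt)
  then show ?thesis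
    using mb_opt_iterate_MAX_contraction[OF assms(1) nonempty, of k m J J']
      mb_opt_iterate_MAX_contraction[OF is_mdp_restrict_to_policy[OF assms(1,4)], of k m J J']
      nonempty
    by simp
qed

end
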